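(* Suppose that the Markov chain $\{S_t\}_{t\ge0}$ induced by the given policy $\pi$ is irreducible for every $P\in\mathcal P_{\mathsf s}$, that $\epsilon>0$, that $\mathcal P$ is $s$-rectangular, and that the stepsizes of the Frank-Wolfe algorithm are $\alpha_m=\mathbb G_m(1-\gamma)^3/(4\gamma^2)$, where $\mathbb G_m=\langle\nabla_PV_\pi^{P^{(m)}}(s_0),P_\epsilon-P^{(m)}\rangle$ and $P_\epsilon$ is the $\epsilon$-optimal solution of the direction-finding subproblem computed in the $m$-th iteration. Then the output $\widehat P$ of the Frank-Wolfe algorithm satisfies $$V_\pi^\star(s_0)-V_\pi^{\widehat P}(s_0)\ \le\ 2\,\delta_d\,\epsilon.$$
   Context: For a finite set $X$, $\Delta(X)$ denotes the probability simplex over $X$. Let $\mathcal S=\{1,\dots,S\}$ be a finite state space, $\mathcal A=\{1,\dots,A\}$ a finite action space, $\gamma\in(0,1)$ a discount factor, and $c:\mathcal S\times\mathcal A\to[0,1]$ a cost function. A transition kernel is $P\in\Delta(\mathcal S)^{S\times A}$ with entries $P(s'|s,a)$, and a stationary policy is $\pi\in\Pi=\Delta(\mathcal A)^S$ with entries $\pi(a|s)$. $\mathbb P_\pi^P$ and $\mathbb E_\pi^P$ denote probability and expectation for the process $(S_t,A_t)_{t\ge0}$ with $A_t\sim\pi(\cdot|S_t)$, $S_{t+1}\sim P(\cdot|S_t,A_t)$; under $\mathbb P_\pi^P$, $\{S_t\}$ is a Markov chain with transition probabilities $P_\pi(s,s')=\sum_aP(s'|s,a)\pi(a|s)$. The value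 function is $V_\pi^P(s)=\mathbb E_\pi^P[\sum_{t=0}^\infty\gamma^tc(S_t,A_t)\mid S_0=s]$. As a function of $P$ it is given by $(I-\gamma P_\pi)^{-1}c_\pi$ with $c_\pi(s)=\sum_a\pi(a|s)c(s,a)$, which is rational and extends to a neighborhood of $\Delta(\mathcal S)^{S\times A}$; $\nabla_PV_\pi^P(s_0)\in\mathbb R^{S\times S\times A}$ is the gradient with respect to the entries of $P$, and $\langle\cdot,\cdot\rangle$ is the Euclidean inner product. The policy $\pi\in\Pi$ and initial state $s_0\in\mathcal S$ are fixed. The uncertainty set is $\mathcal P=\{P^\xi:\xi\in\Xi\}\subseteq\Delta(\mathcal S)^{S\times A}$ with $\Xi\subseteq\mathbb R^q$ convex and compact and $\xi\mapsto P^\xi$ affine (so $\mathcal P$ is convex and compact). The worst-case value function is $V_\pi^\star(s_0)=\max_{P\in\mathcal P}V_\pi^P(s_0)$. A set of kernels is $s$-rectangular if it is of the form $\prod_{s\in\mathcal S}\mathcal P_s$ with $\mathcal P_s\subseteq\Delta(\mathcal S)^A$. $\mathcal P_{\mathsf s}$ denotes the smallest $s$-rectangular set containing $\mathcal P$ (so here $\mathcal P_{\mathsf s}=\mathcal P$). Discounted state visitation distribution: $d_\pi^P(s|s_0)=(1-\gamma)\sum_{t=0}^\infty\gamma^t\,\mathbb P_\pi^P(S_t=s\mid S_0=s_0)$. Distribution mismatch coefficient: $\delta_d=\max_{P,P'\in\mathcal P_{\mathsf s}}\max_{s\in\mathcal S}d_\pi^{P'}(s|s_0)/d_\pi^P(s|s_0)$.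 Frank-Wolfe algorithm (inputs: $P^{(0)}\in\mathcal P$, positive stepsizes $\{\alpha_m\}$, tolerance $\epsilon>0$). In iteration $m=0,1,2,\dots$: (1) find an $\epsilon$-optimal solution $P_\epsilon\in\mathcal P$ of the direction-finding subproblem $\max_{P\in\mathcal P}\langle\nabla_PV_\pi^{P^{(m)}}(s_0),P-P^{(m)}\rangle$, i.e. its objective value is at least the maximum minus $\epsilon$; (2) if $\mathbb G_m=\langle\nabla_PV_\pi^{P^{(m)}}(s_0),P_\epsilon-P^{(m)}\rangle\le\epsilon$, terminate and output $\widehat P=P^{(m)}$; (3) otherwise set $P^{(m+1)}=(1-\alpha_m)P^{(m)}+\alpha_mP_\epsilon$ and continue with $m+1$.
   Formalization: The formal theorem additionally assumes that every iterate P^(m) reached lies in the uncertainty set; this is automatic for γ ≥ 1/5, but for smaller γ the prescribed stepsize can exceed 1 and the output may fail to be a transition kernel. *)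

theory Defs
  imports "HOL-Probability.Probability"
begin

text \<open>A transition kernel is a vector \<open>P\<close> with entries \<open>P $ s $ a $ s' = P(s'|s,a)\<close>, so that
  \<open>P $ s\<close> is the block of \<open>P\<close> belonging to the state \<open>s\<close>, and the inner product of the nested
  vector type is the Euclidean one on all entries.\<close>

type_synonym ('s, 'a) kernel = "real^'s^'a^'s"

definition prob_simplex :: "(real^'n::finite) set" where
  "prob_simplex = {p. (\<forall>i. 0 \<le> p $ i) \<and> (\<Sum>i\<in>UNIV. p $ i) = 1}"

definition kernels :: "('s::finite, 'a::finite) kernel set" where
  "kernels = {P. \<forall>s a. P $ s $ a \<in> prob_simplex}"

definition s_rectangular :: "('s::finite, 'a::finite) kernel set \<Rightarrow> bool" where
  "s_rectangular R \<longleftrightarrow>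
     (\<exists>F. (\<forall>s. F s \<subseteq> {p. \<forall>a. p $ a \<in> prob_simplex}) \<and> R = {P. \<forall>s. P $ s \<in> F s})"


subsection \<open>The controlled process\<close>

text \<open>\<open>embed_pmf\<close> is only meaningful on the simplex, so the definitions of this subsection are only
  meaningful for \<open>P \<in> kernels\<close>.\<close>

definition initial_pmf :: "('s \<Rightarrow> 'a pmf) \<Rightarrow> 's \<Rightarrow> ('s \<times> 'a) pmf" where
  "initial_pmf \<pi> s0 = map_pmf (Pair s0) (\<pi> s0)"

definition step_pmf ::
    "('s::finite \<Rightarrow> 'a::finite pmf) \<Rightarrow> ('s, 'a) kernel \<Rightarrow> 's \<times> 'a \<Rightarrow> ('s \<times> 'a) pmf" where
  "step_pmf \<pi> P = (\<lambda>(s, a).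
     bind_pmf (embed_pmf (\<lambda>s'. P $ s $ a $ s')) (\<lambda>s'. map_pmf (Pair s') (\<pi> s')))"

definition process_step ::
    "('s::finite \<Rightarrow> 'a::finite pmf) \<Rightarrow> ('s, 'a) kernel \<Rightarrow> 's
     \<Rightarrow> nat \<Rightarrow> (nat \<Rightarrow> 's \<times> 'a) \<Rightarrow> ('s \<times> 'a) measure" where
  "process_step \<pi> P s0 t \<omega> =
     measure_pmf (case t of 0 \<Rightarrow> initial_pmf \<pi> s0 | Suc k \<Rightarrow> step_pmf \<pi> P (\<omega> k))"

lemma Ionescu_Tulcea_process_step:
  "Ionescu_Tulcea (process_step \<pi> P s0) (\<lambda>_. count_space UNIV)"
proof
  fix i :: nat
  show "process_step \<pi> P s0 i \<in>
      (\<Pi>\<^sub>M _\<in>{0..<i}. count_space UNIV) \<rightarrow>\<^sub>M subprob_algebra (count_space UNIV)"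
  proof (cases i)
    case 0
    then show ?thesis
      by (simp add: process_step_def[abs_def] measure_pmf_in_subprob_algebra)
  next
    case (Suc k)
    have "(\<lambda>\<omega>. measure_pmf (step_pmf \<pi> P (\<omega> k))) \<in>
        (\<Pi>\<^sub>M _\<in>{0..<Suc k}. count_space UNIV) \<rightarrow>\<^sub>M subprob_algebra (count_space UNIV)"
      by (rule measurable_compose[OF measurable_component_singleton])
         (auto simp: measure_pmf_in_subprob_algebra)
    with Suc show ?thesis
      by (simp add: process_step_def[abs_def])
  qed
qed (auto simp: process_step_def measure_pmf.prob_space_axioms)

text \<open>The law of \<open>(S\<^sub>t, A\<^sub>t)\<^sub>t\<close> under \<open>\<pi>\<close> and \<open>P\<close>, conditioned on \<open>S\<^sub>0 = s0\<close>; along a trajectory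
  \<open>\<omega>\<close>, \<open>S\<^sub>t = fst (\<omega> t)\<close> and \<open>A\<^sub>t = snd (\<omega> t)\<close>.\<close>

definition process ::
    "('s::finite \<Rightarrow> 'a::finite pmf) \<Rightarrow> ('s, 'a) kernel \<Rightarrow> 's \<Rightarrow> (nat \<Rightarrow> 's \<times> 'a) measure" where
  "process \<pi> P s0 =
     projective_family.lim UNIV
       (Ionescu_Tulcea.CI (process_step \<pi> P s0) (\<lambda>_. count_space UNIV)) (\<lambda>_. count_space UNIV)"

definition irreducible_chain ::
    "('s::finite \<Rightarrow> 'a::finite pmf) \<Rightarrow> ('s, 'a) kernel \<Rightarrow> bool" where
  "irreducible_chain \<pi> P \<longleftrightarrow>
     (\<forall>s s'. \<exists>t. 0 < \<P>(\<omega> in process \<pi> P s. fst (\<omega> t) = s'))"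

definition visitation ::
    "real \<Rightarrow> ('s::finite \<Rightarrow> 'a::finite pmf) \<Rightarrow> ('s, 'a) kernel \<Rightarrow> 's \<Rightarrow> 's \<Rightarrow> real" where
  "visitation \<gamma> \<pi> P s0 s =
     (1 - \<gamma>) * (\<Sum>t. \<gamma> ^ t * \<P>(\<omega> in process \<pi> P s0. fst (\<omega> t) = s))"

definition value_fun ::
    "real \<Rightarrow> ('s::finite \<Rightarrow> 'a::finite \<Rightarrow> real) \<Rightarrow> ('s \<Rightarrow> 'a pmf) \<Rightarrow> ('s, 'a) kernel \<Rightarrow> 's \<Rightarrow> real" where
  "value_fun \<gamma> c \<pi> P s0 =
     (\<integral>\<omega>. (\<Sum>t. \<gamma> ^ t * c (fst (\<omega> t)) (snd (\<omega> t))) \<partial>process \<pi> P s0)"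


subsection \<open>The gradient of the value function\<close>

text \<open>The value function is only defined on \<^const>\<open>kernels\<close>, which has empty interior; the gradient is
  that of its rational extension \<open>(I - \<gamma> P\<^sub>\<pi>)\<^sup>-\<^sup>1 c\<^sub>\<pi>\<close>.\<close>

definition state_matrix ::
    "('s::finite \<Rightarrow> 'a::finite pmf) \<Rightarrow> ('s, 'a) kernel \<Rightarrow> real^'s^'s" where
  "state_matrix \<pi> P = (\<chi> s s'. \<Sum>a\<in>UNIV. P $ s $ a $ s' * pmf (\<pi> s) a)"

definition policy_cost ::
    "('s::finite \<Rightarrow> 'a::finite \<Rightarrow> real) \<Rightarrow> ('s \<Rightarrow> 'a pmf) \<Rightarrow> real^'s" where
  "policy_cost c \<pi> = (\<chi> s. \<Sum>a\<in>UNIV. pmf (\<pi> s) a * c s a)"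

definition value_ext ::
    "real \<Rightarrow> ('s::finite \<Rightarrow> 'a::finite \<Rightarrow> real) \<Rightarrow> ('s \<Rightarrow> 'a pmf) \<Rightarrow> ('s, 'a) kernel \<Rightarrow> 's \<Rightarrow> real" where
  "value_ext \<gamma> c \<pi> P s0 =
     (matrix_inv (mat 1 - \<gamma> *\<^sub>R state_matrix \<pi> P) *v policy_cost c \<pi>) $ s0"

definition value_grad ::
    "real \<Rightarrow> ('s::finite \<Rightarrow> 'a::finite \<Rightarrow> real) \<Rightarrow> ('s \<Rightarrow> 'a pmf) \<Rightarrow> 's
     \<Rightarrow> ('s, 'a) kernel \<Rightarrow> ('s, 'a) kernel" where
  "value_grad \<gamma> c \<pi> s0 P = (THE D. GDERIV (\<lambda>P. value_ext \<gamma> c \<pi> P s0) P :> D)"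


subsection \<open>Worst-case value and distribution mismatch coefficient\<close>

definition worst_case_value ::
    "real \<Rightarrow> ('s::finite \<Rightarrow> 'a::finite \<Rightarrow> real) \<Rightarrow> ('s \<Rightarrow> 'a pmf) \<Rightarrow> ('s, 'a) kernel set
     \<Rightarrow> 's \<Rightarrow> real" where
  "worst_case_value \<gamma> c \<pi> U s0 = (GREATEST v. v \<in> (\<lambda>P. value_fun \<gamma> c \<pi> P s0) ` U)"

definition mismatch_coeff ::
    "real \<Rightarrow> ('s::finite \<Rightarrow> 'a::finite pmf) \<Rightarrow> ('s, 'a) kernel set \<Rightarrow> 's \<Rightarrow> real" where
  "mismatch_coeff \<gamma> \<pi> U s0 =
     (GREATEST r. \<exists>P \<in> s_rectangular hull U. \<exists>P' \<in> s_rectangular hull U. \<exists>s.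
        r = visitation \<gamma> \<pi> P' s0 s / visitation \<gamma> \<pi> P s0 s)"


subsection \<open>The Frank-Wolfe algorithm\<close>

definition fw_gap ::
    "real \<Rightarrow> ('s::finite \<Rightarrow> 'a::finite \<Rightarrow> real) \<Rightarrow> ('s \<Rightarrow> 'a pmf) \<Rightarrow> 's
     \<Rightarrow> ('s, 'a) kernel \<Rightarrow> ('s, 'a) kernel \<Rightarrow> real" where
  "fw_gap \<gamma> c \<pi> s0 P Q = inner (value_grad \<gamma> c \<pi> s0 P) (Q - P)"

definition eps_optimal_direction ::
    "real \<Rightarrow> ('s::finite \<Rightarrow> 'a::finite \<Rightarrow> real) \<Rightarrow> ('s \<Rightarrow> 'a pmf) \<Rightarrow> 's
     \<Rightarrow> ('s, 'a) kernel set \<Rightarrow> real \<Rightarrow> ('s, 'a) kernel \<Rightarrow> ('s, 'a) kernel \<Rightarrow> bool" where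
  "eps_optimal_direction \<gamma> c \<pi> s0 U \<epsilon> P Q \<longleftrightarrow>
     Q \<in> U \<and> (\<forall>P'\<in>U. fw_gap \<gamma> c \<pi> s0 P P' - \<epsilon> \<le> fw_gap \<gamma> c \<pi> s0 P Q)"

text \<open>An execution is given by sequences \<open>Pm\<close> (the iterates) and \<open>Qm\<close> (the computed
  \<open>\<epsilon>\<close>-optimal solutions) that are constrained only as long as the algorithm has not terminated.
  Iteration \<open>m\<close> is executed iff no earlier iteration met the termination test; hence the stepsize
  \<open>\<alpha> m\<close> is used iff iteration \<open>Suc m\<close> is executed.\<close>

definition fw_executed ::
    "real \<Rightarrow> ('s::finite \<Rightarrow> 'a::finite \<Rightarrow> real) \<Rightarrow> ('s \<Rightarrow> 'a pmf) \<Rightarrow> 's \<Rightarrow> real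
     \<Rightarrow> (nat \<Rightarrow> ('s, 'a) kernel) \<Rightarrow> (nat \<Rightarrow> ('s, 'a) kernel) \<Rightarrow> nat \<Rightarrow> bool" where
  "fw_executed \<gamma> c \<pi> s0 \<epsilon> Pm Qm m \<longleftrightarrow> (\<forall>k<m. \<epsilon> < fw_gap \<gamma> c \<pi> s0 (Pm k) (Qm k))"

definition frank_wolfe_run ::
    "real \<Rightarrow> ('s::finite \<Rightarrow> 'a::finite \<Rightarrow> real) \<Rightarrow> ('s \<Rightarrow> 'a pmf) \<Rightarrow> 's
     \<Rightarrow> ('s, 'a) kernel set \<Rightarrow> real \<Rightarrow> (nat \<Rightarrow> real)
     \<Rightarrow> (nat \<Rightarrow> ('s, 'a) kernel) \<Rightarrow> (nat \<Rightarrow> ('s, 'a) kernel) \<Rightarrow> bool" where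
  "frank_wolfe_run \<gamma> c \<pi> s0 U \<epsilon> \<alpha> Pm Qm \<longleftrightarrow>
     Pm 0 \<in> U \<and>
     (\<forall>m. fw_executed \<gamma> c \<pi> s0 \<epsilon> Pm Qm m \<longrightarrow>
        eps_optimal_direction \<gamma> c \<pi> s0 U \<epsilon> (Pm m) (Qm m)) \<and>
     (\<forall>m. fw_executed \<gamma> c \<pi> s0 \<epsilon> Pm Qm (Suc m) \<longrightarrow>
        Pm (Suc m) = (1 - \<alpha> m) *\<^sub>R Pm m + \<alpha> m *\<^sub>R Qm m)"

definition fw_output ::
    "real \<Rightarrow> ('s::finite \<Rightarrow> 'a::finite \<Rightarrow> real) \<Rightarrow> ('s \<Rightarrow> 'a pmf) \<Rightarrow> 's \<Rightarrow> real
     \<Rightarrow> (nat \<Rightarrow> ('s, 'a) kernel) \<Rightarrow> (nat \<Rightarrow> ('s, 'a) kernel) \<Rightarrow> ('s, 'a) kernel \<Rightarrow> bool" where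
  "fw_output \<gamma> c \<pi> s0 \<epsilon> Pm Qm Phat \<longleftrightarrow>
     (\<exists>m. fw_executed \<gamma> c \<pi> s0 \<epsilon> Pm Qm m \<and> fw_gap \<gamma> c \<pi> s0 (Pm m) (Qm m) \<le> \<epsilon> \<and> Phat = Pm m)"

end

theory Submission
  imports Defs
begin

text \<open>
  Write \<open>M\<close> for the state transition matrix of a kernel \<open>P\<close>. The process enters only through the
  marginal laws of its coordinates, and the laws of the states are the rows of the powers of \<open>M\<close>. Summing
  these powers with weights \<open>\<gamma> ^ t\<close> gives the occupancy matrix \<open>R = (I - \<gamma> M)\<^sup>-\<^sup>1\<close>, which is nonnegative, has row sums
  \<open>1 / (1 - \<gamma>)\<close>, and yields the visitation distribution \<open>(1 - \<gamma>) R(s0, \<cdot>)\<close> and the value vector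
  \<open>v = R c\<^sub>\<pi>\<close>.

  Everything else rests on one exact identity for two kernels \<open>P\<close> and \<open>Q\<close>
  (\<open>matrix_inv_diff_mult_vec\<close>):
  \<open>v\<^sub>Q - v\<^sub>P = \<gamma> R\<^sub>P (M\<^sub>Q - M\<^sub>P) v\<^sub>Q\<close>. It is used three times.

  For the gradient: the right-hand side is linear in \<open>Q - P\<close> with a coefficient that depends
  continuously on \<open>Q\<close>, so that the derivative at \<open>P\<close> in direction \<open>Q - P\<close> is
  \<open>\<gamma> (R\<^sub>P (M\<^sub>Q - M\<^sub>P) v\<^sub>P)(s0)\<close> (\<open>fw_gap_formula\<close>).

  For gradient dominance (\<open>gradient_dominance\<close>): exchanging the two kernels gives
  \<open>v\<^sub>P\<^sub>' - v\<^sub>P = \<gamma> R\<^sub>P\<^sub>' g\<close> with \<open>g = (M\<^sub>P\<^sub>' - M\<^sub>P) v\<^sub>P\<close>. By \<open>s\<close>-rectangularity the kernel \<open>Q\<close> that uses the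
  block of \<open>P'\<close> at the states with \<open>g \<ge> 0\<close>, and the block of \<open>P\<close> elsewhere, is admissible. It replaces \<open>g\<close>
  by its positive part, after which passing from the weights \<open>R\<^sub>P\<^sub>'(s0, \<cdot>)\<close> to \<open>R\<^sub>P(s0, \<cdot>)\<close> costs at most
  the factor \<open>\<delta>\<^sub>d\<close>. The result is \<open>\<delta>\<^sub>d\<close> times the Frank-Wolfe gap of \<open>Q\<close>, and at termination every such gap
  is at most \<open>2 \<epsilon>\<close>: the computed direction has gap at most \<open>\<epsilon>\<close> and is \<open>\<epsilon>\<close>-optimal.

  For termination (\<open>value_vec_ascent\<close>, \<open>fw_terminates\<close>): inserting the identity into itself bounds the second order
  remainder of a step of size \<open>\<alpha>\<close> by \<open>2 \<gamma>\<^sup>2 \<alpha>\<^sup>2 / (1 - \<gamma>)\<^sup>3\<close>. The prescribed stepsize maximizes the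
  resulting lower bound, so each iteration that does not stop gains at least
  \<open>\<epsilon>\<^sup>2 (1 - \<gamma>)\<^sup>3 / (8 \<gamma>\<^sup>2)\<close>, while all values lie in \<open>[0, 1 / (1 - \<gamma>)]\<close>.
\<close>

section \<open>Marginals of a process with Markovian transitions\<close>

lemma (in Ionescu_Tulcea) distr_lim_component:
  "distr PF.lim (M t) (\<lambda>\<omega>. \<omega> t) = distr (C 0 (Suc t) (\<lambda>_. undefined)) (M t) (\<lambda>\<omega>. \<omega> t)"
proof -
  let ?J = "{0..<Suc t}" and ?u = "\<lambda>_. undefined"
  have u: "?u \<in> space (PiM {0..<0} M)"
    by simp
  have up: "up_to ?J \<le> Suc t"
    by (subst up_to_iff) auto
  have "Suc t \<le> up_to ?J"
    using up_to_less[of ?J t] by simp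
  with up have up_eq: "up_to ?J = Suc t"
    by simp
  have CI: "CI ?J = C 0 (Suc t) ?u"
    unfolding CI_def up_eq using distr_C[of "Suc t" "Suc t" ?u 0] u by simp
  have comp: "(\<lambda>\<omega>. \<omega> t) \<in> PiM ?J M \<rightarrow>\<^sub>M M t"
    by (rule measurable_component_singleton) simp
  have res: "(\<lambda>\<omega>. restrict \<omega> ?J) \<in> PF.lim \<rightarrow>\<^sub>M PiM ?J M"
    by (simp add: measurable_cong_sets[OF PF.sets_lim refl] measurable_restrict_subset)
  have "distr PF.lim (M t) (\<lambda>\<omega>. \<omega> t) = distr PF.lim (M t) ((\<lambda>\<omega>. \<omega> t) \<circ> (\<lambda>\<omega>. restrict \<omega> ?J))"
    by (rule distr_cong) auto
  also have "\<dots> = distr (distr PF.lim (PiM ?J M) (\<lambda>\<omega>. restrict \<omega> ?J)) (M t) (\<lambda>\<omega>. \<omega> t)"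
    by (rule distr_distr[symmetric, OF comp res])
  also have "\<dots> = distr (C 0 (Suc t) ?u) (M t) (\<lambda>\<omega>. \<omega> t)"
    by (simp only: distr_lim finite_atLeastLessThan CI)
  finally show ?thesis .
qed

text \<open>The first \<open>t\<close> coordinates have law \<open>C 0 t\<close>, and coordinate \<open>t\<close> is then drawn from \<open>P t\<close>; projecting the
  extension kernel \<open>eP t\<close> to coordinate \<open>t\<close> undoes the bookkeeping by which it appends to the history.\<close>

lemma (in Ionescu_Tulcea) distr_lim_component_bind:
  "distr PF.lim (M t) (\<lambda>\<omega>. \<omega> t) = C 0 t (\<lambda>_. undefined) \<bind> P t"
proof -
  let ?u = "\<lambda>_. undefined"
  have u: "?u \<in> space (PiM {0..<0} M)"
    by simp
  have sp: "space (C 0 t ?u) = space (PiM {0..<t} M)"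
    using space_C[OF u] by simp
  have ne: "space (C 0 t ?u) \<noteq> {}"
    using prob_space.not_empty[OF prob_space_C[OF u]] by simp
  have comp: "(\<lambda>\<omega>. \<omega> t) \<in> PiM {0..<Suc t} M \<rightarrow>\<^sub>M M t"
    by (rule measurable_component_singleton) simp
  have eP: "eP t \<in> C 0 t ?u \<rightarrow>\<^sub>M subprob_algebra (PiM {0..<Suc t} M)"
    using measurable_eP[of t] by (simp add: measurable_cong_sets[OF sets_C[OF u] refl])
  have "distr (C 0 (Suc t) ?u) (M t) (\<lambda>\<omega>. \<omega> t) = C 0 t ?u \<bind> (\<lambda>\<omega>. distr (eP t \<omega>) (M t) (\<lambda>\<omega>. \<omega> t))"
    using distr_bind[OF eP ne comp] by simp
  also have "\<dots> = C 0 t ?u \<bind> P t"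
  proof (rule bind_cong[OF refl])
    fix \<omega> assume "\<omega> \<in> space (C 0 t ?u)"
    then have \<omega>: "\<omega> \<in> space (PiM {0..<t} M)"
      by (simp add: sp)
    have upd: "fun_upd \<omega> t \<in> P t \<omega> \<rightarrow>\<^sub>M PiM {0..<Suc t} M"
      using \<omega> by (intro measurable_fun_upd[where J="{0..<t}"]) (auto simp: measurable_cong_sets[OF sets_P refl])
    have "distr (eP t \<omega>) (M t) (\<lambda>\<omega>. \<omega> t) = distr (P t \<omega>) (M t) (\<lambda>x. x)"
      unfolding eP_def by (subst distr_distr[OF comp upd]) (auto simp: comp_def)
    also have "\<dots> = P t \<omega>"
      by (rule distr_id2) (simp add: sets_P[OF \<omega>])
    finally show "distr (eP t \<omega>) (M t) (\<lambda>\<omega>. \<omega> t) = P t \<omega>" .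
  qed
  finally show ?thesis
    by (simp add: distr_lim_component)
qed

text \<open>When the next transition reads only the last coordinate, the history can be integrated out, and the
  one-dimensional marginals obey a recursion of their own.\<close>

lemma (in Ionescu_Tulcea) distr_lim_Suc_markov:
  assumes K: "K \<in> M t \<rightarrow>\<^sub>M subprob_algebra (M (Suc t))"
    and markov: "\<And>\<omega>. P (Suc t) \<omega> = K (\<omega> t)"
  shows "distr PF.lim (M (Suc t)) (\<lambda>\<omega>. \<omega> (Suc t)) = distr PF.lim (M t) (\<lambda>\<omega>. \<omega> t) \<bind> K"
proof -
  let ?u = "\<lambda>_. undefined"
  have u: "?u \<in> space (PiM {0..<0} M)"
    by simp
  have ne: "space (C 0 (Suc t) ?u) \<noteq> {}"
    using prob_space.not_empty[OF prob_space_C[OF u]] by blast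
  have comp: "(\<lambda>\<omega>. \<omega> t) \<in> C 0 (Suc t) ?u \<rightarrow>\<^sub>M M t"
    unfolding measurable_cong_sets[OF sets_C[OF u] refl]
    by (rule measurable_component_singleton) simp
  have "distr PF.lim (M (Suc t)) (\<lambda>\<omega>. \<omega> (Suc t)) = C 0 (Suc t) ?u \<bind> (\<lambda>\<omega>. K (\<omega> t))"
    by (simp only: distr_lim_component_bind markov[abs_def])
  also have "\<dots> = distr (C 0 (Suc t) ?u) (M t) (\<lambda>\<omega>. \<omega> t) \<bind> K"
    by (rule bind_distr[OF comp K ne, symmetric])
  finally show ?thesis
    by (simp only: distr_lim_component)
qed

section \<open>Matrix inverses, gradients and maxima\<close>

lemma matrix_inv_right_left:
  fixes A :: "real^'n^'n"
  assumes "invertible A"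
  shows "A ** matrix_inv A = mat 1" "matrix_inv A ** A = mat 1"
proof -
  have "A ** matrix_inv A = mat 1 \<and> matrix_inv A ** A = mat 1"
    using assms unfolding invertible_def matrix_inv_def by (rule someI_ex)
  then show "A ** matrix_inv A = mat 1" "matrix_inv A ** A = mat 1"
    by simp_all
qed

lemma tendsto_det:
  fixes f :: "'x \<Rightarrow> real^'n^'n"
  assumes "(f \<longlongrightarrow> A) F"
  shows "((\<lambda>x. det (f x)) \<longlongrightarrow> det A) F"
  unfolding det_def by (intro tendsto_intros assms)

text \<open>By Cramer's rule the entries of the solution are quotients of determinants, hence continuous where the
  matrix is invertible.\<close>

lemma tendsto_matrix_inv_mult_vec:
  fixes f :: "'x \<Rightarrow> real^'n^'n"
  assumes f: "(f \<longlongrightarrow> A) F" and A: "invertible A"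
  shows "((\<lambda>x. matrix_inv (f x) *v b) \<longlongrightarrow> matrix_inv A *v b) F"
proof -
  define num where "num B k = det (\<chi> i j. if j = k then b $ i else B $ i $ j)" for B :: "real^'n^'n" and k
  have cramer_inv: "matrix_inv B *v b = (\<chi> k. num B k / det B)" if "det B \<noteq> 0" for B
  proof -
    have "B *v (matrix_inv B *v b) = b"
      using that by (simp add: matrix_vector_mul_assoc matrix_inv_right_left invertible_det_nz)
    then show ?thesis
      using cramer[OF that] unfolding num_def by blast
  qed
  have det: "((\<lambda>x. det (f x)) \<longlongrightarrow> det A) F"
    by (rule tendsto_det[OF f])
  have nz: "det A \<noteq> 0"
    using A by (simp add: invertible_det_nz)
  have "((\<lambda>x. num (f x) k) \<longlongrightarrow> num A k) F" for k
    unfolding num_def by (intro tendsto_det vec_tendstoI) (auto intro!: tendsto_intros f)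
  then have "((\<lambda>x. \<chi> k. num (f x) k / det (f x)) \<longlongrightarrow> (\<chi> k. num A k / det A)) F"
    using det nz by (intro tendsto_intros)
  moreover have "eventually (\<lambda>x. (\<chi> k. num (f x) k / det (f x)) = matrix_inv (f x) *v b) F"
    using tendsto_imp_eventually_ne[OF det nz] by eventually_elim (simp add: cramer_inv)
  ultimately show ?thesis
    unfolding cramer_inv[OF nz] by (rule Lim_transform_eventually)
qed

text \<open>The second resolvent identity. With \<open>y = (I - \<gamma> N)\<^sup>-\<^sup>1 b\<close> it says that \<open>(I - \<gamma> M) y = b + \<gamma> (N - M) y\<close>, solved
  for \<open>y\<close>. Being exact, it serves both for derivatives and for comparing kernels that are far apart.\<close>

lemma matrix_inv_diff_mult_vec:
  fixes M N :: "real^'n^'n"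
  assumes M: "invertible (mat 1 - \<gamma> *\<^sub>R M)" and N: "invertible (mat 1 - \<gamma> *\<^sub>R N)"
  shows "matrix_inv (mat 1 - \<gamma> *\<^sub>R N) *v b - matrix_inv (mat 1 - \<gamma> *\<^sub>R M) *v b =
    \<gamma> *\<^sub>R (matrix_inv (mat 1 - \<gamma> *\<^sub>R M) *v ((N - M) *v (matrix_inv (mat 1 - \<gamma> *\<^sub>R N) *v b)))"
proof -
  let ?A = "mat 1 - \<gamma> *\<^sub>R M" and ?B = "mat 1 - \<gamma> *\<^sub>R N"
  define y where "y = matrix_inv ?B *v b"
  have b: "b = ?B *v y"
    unfolding y_def by (simp add: matrix_vector_mul_assoc matrix_inv_right_left[OF N])
  have y: "y = matrix_inv ?A *v (?A *v y)"
    by (simp add: matrix_vector_mul_assoc matrix_inv_right_left[OF M])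
  have "y - matrix_inv ?A *v b = matrix_inv ?A *v (?A *v y - ?B *v y)"
    by (subst (1) y, subst b) (simp add: matrix_vector_mult_diff_distrib)
  also have "?A *v y - ?B *v y = \<gamma> *\<^sub>R ((N - M) *v y)"
    by (simp add: matrix_vector_mult_diff_rdistrib scaleR_matrix_vector_assoc scaleR_right_diff_distrib)
  finally show ?thesis
    unfolding y_def by (simp add: linear_scale[OF matrix_vector_mul_linear])
qed

text \<open>Caratheodory's form of differentiability: a factorization of the increment whose coefficient is
  merely continuous at the point suffices, so no derivative of the matrix inverse has to be computed.\<close>

lemma GDERIV_inner_diff:
  fixes g :: "'x::real_inner \<Rightarrow> 'x"
  assumes g: "(g \<longlongrightarrow> D) (at x)"
    and f: "eventually (\<lambda>y. f y - f x = inner (y - x) (g y)) (at x)"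
  shows "GDERIV f x :> D"
  unfolding gderiv_def has_derivative_iff_norm
proof (intro conjI)
  show "bounded_linear (\<lambda>h. inner h D)"
    by (rule bounded_linear_inner_left)
  have "((\<lambda>y. norm (g y - D)) \<longlongrightarrow> 0) (at x)"
    using g by (simp add: tendsto_norm_zero LIM_zero)
  then show "((\<lambda>y. norm (f y - f x - inner (y - x) D) / norm (y - x)) \<longlongrightarrow> 0) (at x)"
  proof (rule Lim_null_comparison[rotated])
    show "eventually (\<lambda>y. norm (norm (f y - f x - inner (y - x) D) / norm (y - x)) \<le> norm (g y - D)) (at x)"
      using f eventually_neq_at_within[of x x UNIV]
    proof eventually_elim
      case (elim y)
      have "norm (f y - f x - inner (y - x) D) = \<bar>inner (y - x) (g y - D)\<bar>"
        using elim by (simp add: inner_diff_right)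
      also have "\<dots> \<le> norm (y - x) * norm (g y - D)"
        by (rule Cauchy_Schwarz_ineq2)
      finally show ?case
        using elim by (simp add: field_simps)
    qed
  qed
qed

lemma GDERIV_unique:
  assumes "GDERIV f x :> D" "GDERIV f x :> E"
  shows "D = E"
proof -
  have "(\<lambda>h. inner h D) = (\<lambda>h. inner h E)"
    using assms unfolding gderiv_def by (rule has_derivative_unique)
  then have "inner (D - E) D = inner (D - E) E"
    by (rule fun_cong)
  then have "inner (D - E) (D - E) = 0"
    by (simp add: inner_diff_right)
  then show ?thesis
    by simp
qed

text \<open>\<open>GREATEST\<close> denotes a maximum only if there is one; compactness provides it.\<close>

lemma attained_Greatest:
  fixes A :: "real set"
  assumes "compact A" "A \<noteq> {}"
  shows "(GREATEST x. x \<in> A) \<in> A" "\<And>y. y \<in> A \<Longrightarrow> y \<le> (GREATEST x. x \<in> A)"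
proof -
  obtain m where m: "m \<in> A" "\<And>y. y \<in> A \<Longrightarrow> y \<le> m"
    using compact_attains_sup[OF assms] by blast
  then have "(GREATEST x. x \<in> A) = m"
    by (intro Greatest_equality) auto
  with m show "(GREATEST x. x \<in> A) \<in> A" "\<And>y. y \<in> A \<Longrightarrow> y \<le> (GREATEST x. x \<in> A)"
    by auto
qed

section \<open>The law of the controlled process\<close>

primrec state_law ::
    "('s::finite \<Rightarrow> 'a::finite pmf) \<Rightarrow> ('s, 'a) kernel \<Rightarrow> 's \<Rightarrow> nat \<Rightarrow> 's pmf" where
  "state_law \<pi> P s0 0 = return_pmf s0"
| "state_law \<pi> P s0 (Suc t) =
     bind_pmf (state_law \<pi> P s0 t) (\<lambda>s. bind_pmf (\<pi> s) (\<lambda>a. embed_pmf (\<lambda>s'. P $ s $ a $ s')))"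

definition state_action_law ::
    "('s::finite \<Rightarrow> 'a::finite pmf) \<Rightarrow> ('s, 'a) kernel \<Rightarrow> 's \<Rightarrow> nat \<Rightarrow> ('s \<times> 'a) pmf" where
  "state_action_law \<pi> P s0 t = bind_pmf (state_law \<pi> P s0 t) (\<lambda>s. map_pmf (Pair s) (\<pi> s))"

lemma state_action_law_0: "state_action_law \<pi> P s0 0 = initial_pmf \<pi> s0"
  by (simp add: state_action_law_def initial_pmf_def bind_return_pmf)

lemma state_action_law_Suc:
  "state_action_law \<pi> P s0 (Suc t) = bind_pmf (state_action_law \<pi> P s0 t) (step_pmf \<pi> P)"
  by (simp add: state_action_law_def step_pmf_def bind_assoc_pmf bind_map_pmf)

text \<open>The transitions of \<^const>\<open>process_step\<close> are Markovian on state-action pairs, so the recursion for marginals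
  identifies each of them with a probability mass function on a finite type.\<close>

lemma process_marginal:
  "distr (process \<pi> P s0) (count_space UNIV) (\<lambda>\<omega>. \<omega> t) = measure_pmf (state_action_law \<pi> P s0 t)"
proof -
  interpret Ionescu_Tulcea "process_step \<pi> P s0" "\<lambda>_. count_space UNIV"
    by (rule Ionescu_Tulcea_process_step)
  have lim: "process \<pi> P s0 = PF.lim"
    by (simp add: process_def)
  show ?thesis
    unfolding lim
  proof (induction t)
    case 0
    have "C 0 0 (\<lambda>_. undefined) \<bind> process_step \<pi> P s0 0 = process_step \<pi> P s0 0 (\<lambda>_. undefined)"
      using bind_return[OF P[of 0]] by simp
    then show ?case
      unfolding distr_lim_component_bind by (simp add: process_step_def state_action_law_0)
  next
    case (Suc t)
    have K: "(\<lambda>x. measure_pmf (step_pmf \<pi> P x)) \<in> count_space UNIV \<rightarrow>\<^sub>M subprob_algebra (count_space UNIV)"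
      by (simp add: measure_pmf_in_subprob_algebra)
    show ?case
      by (subst distr_lim_Suc_markov[OF K])
         (simp_all add: process_step_def Suc.IH state_action_law_Suc measure_pmf_bind)
  qed
qed

lemma prob_space_process: "prob_space (process \<pi> P s0)"
proof (rule prob_space_distrD)
  interpret Ionescu_Tulcea "process_step \<pi> P s0" "\<lambda>_. count_space UNIV"
    by (rule Ionescu_Tulcea_process_step)
  show "(\<lambda>\<omega>. \<omega> 0) \<in> process \<pi> P s0 \<rightarrow>\<^sub>M count_space UNIV"
    by (simp add: process_def measurable_cong_sets[OF PF.sets_lim refl])
  show "prob_space (distr (process \<pi> P s0) (count_space UNIV) (\<lambda>\<omega>. \<omega> 0))"
    by (simp add: process_marginal measure_pmf.prob_space_axioms)
qed

lemma measurable_process_component [measurable]: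
  "(\<lambda>\<omega>. \<omega> t) \<in> process \<pi> P s0 \<rightarrow>\<^sub>M count_space UNIV"
proof -
  interpret Ionescu_Tulcea "process_step \<pi> P s0" "\<lambda>_. count_space UNIV"
    by (rule Ionescu_Tulcea_process_step)
  show ?thesis
    by (simp add: process_def measurable_cong_sets[OF PF.sets_lim refl])
qed

lemma map_fst_state_action_law: "map_pmf fst (state_action_law \<pi> P s0 t) = state_law \<pi> P s0 t"
  by (simp add: state_action_law_def map_bind_pmf map_pmf_comp bind_return_pmf')

lemma prob_process_state:
  "\<P>(\<omega> in process \<pi> P s0. fst (\<omega> t) = s) = pmf (state_law \<pi> P s0 t) s"
proof -
  have "\<P>(\<omega> in process \<pi> P s0. fst (\<omega> t) = s)
      = measure (distr (process \<pi> P s0) (count_space UNIV) (\<lambda>\<omega>. \<omega> t)) {x. fst x = s}"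
    by (subst measure_distr) (auto intro!: arg_cong[where f="measure _"])
  also have "\<dots> = pmf (map_pmf fst (state_action_law \<pi> P s0 t)) s"
    by (simp add: process_marginal pmf_map vimage_def)
  finally show ?thesis
    by (simp add: map_fst_state_action_law)
qed

lemma expectation_process_cost:
  "(\<integral>\<omega>. c (fst (\<omega> t)) (snd (\<omega> t)) \<partial>process \<pi> P s0) =
     (\<Sum>s\<in>UNIV. pmf (state_law \<pi> P s0 t) s * policy_cost c \<pi> $ s)"
proof -
  let ?f = "\<lambda>x. c (fst x) (snd x)"
  have "(\<integral>\<omega>. c (fst (\<omega> t)) (snd (\<omega> t)) \<partial>process \<pi> P s0)
      = (\<integral>x. ?f x \<partial>distr (process \<pi> P s0) (count_space UNIV) (\<lambda>\<omega>. \<omega> t))"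
    by (subst integral_distr) auto
  also have "\<dots> = (\<integral>x. ?f x \<partial>measure_pmf (state_action_law \<pi> P s0 t))"
    by (simp add: process_marginal)
  also have "\<dots> = (\<Sum>x\<in>UNIV. pmf (state_action_law \<pi> P s0 t) x * ?f x)"
    by (subst integral_measure_pmf[where A=UNIV]) auto
  also have "\<dots> = (\<Sum>s\<in>UNIV. \<Sum>a\<in>UNIV. pmf (state_action_law \<pi> P s0 t) (s, a) * c s a)"
    by (simp add: sum.cartesian_product UNIV_Times_UNIV[symmetric] case_prod_beta del: UNIV_Times_UNIV)
  also have "\<dots> = (\<Sum>s\<in>UNIV. pmf (state_law \<pi> P s0 t) s * policy_cost c \<pi> $ s)"
  proof (rule sum.cong[OF refl])
    fix s
    have pair: "pmf (state_action_law \<pi> P s0 t) (s, a) = pmf (state_law \<pi> P s0 t) s * pmf (\<pi> s) a" for a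
    proof -
      have *: "pmf (map_pmf (Pair s') (\<pi> s')) (s, a) = (if s' = s then pmf (\<pi> s) a else 0)" for s'
      proof (cases "s' = s")
        case True
        then show ?thesis
          using pmf_map_inj'[of "Pair s" "\<pi> s" a] by (simp add: inj_def)
      qed (auto simp: pmf_eq_0_set_pmf)
      then show ?thesis
        by (simp add: state_action_law_def pmf_bind integral_measure_pmf[where A=UNIV] * if_distrib cong: if_cong)
    qed
    show "(\<Sum>a\<in>UNIV. pmf (state_action_law \<pi> P s0 t) (s, a) * c s a) = pmf (state_law \<pi> P s0 t) s * policy_cost c \<pi> $ s"
      by (simp add: pair policy_cost_def sum_distrib_left mult_ac)
  qed
  finally show ?thesis .
qed

section \<open>Transition matrices and discounted occupancies\<close>

lemma pmf_kernel:
  assumes "P \<in> kernels"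
  shows "pmf (embed_pmf (\<lambda>s'. P $ s $ a $ s')) s' = P $ s $ a $ s'"
proof (rule pmf_embed_pmf)
  have simplex: "P $ s $ a \<in> prob_simplex"
    using assms by (simp add: kernels_def)
  then show "0 \<le> P $ s $ a $ x" for x
    by (simp add: prob_simplex_def)
  then have "(\<integral>\<^sup>+ x. ennreal (P $ s $ a $ x) \<partial>count_space UNIV) = ennreal (\<Sum>x\<in>UNIV. P $ s $ a $ x)"
    by (simp add: nn_integral_count_space_finite sum_ennreal)
  with simplex show "(\<integral>\<^sup>+ x. ennreal (P $ s $ a $ x) \<partial>count_space UNIV) = 1"
    by (simp add: prob_simplex_def)
qed

lemma state_matrix_nonneg: "P \<in> kernels \<Longrightarrow> 0 \<le> state_matrix \<pi> P $ s $ s'"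
  by (simp add: state_matrix_def kernels_def prob_simplex_def sum_nonneg)

lemma state_matrix_row_sum:
  assumes "P \<in> kernels"
  shows "(\<Sum>s'\<in>UNIV. state_matrix \<pi> P $ s $ s') = 1"
proof -
  have "(\<Sum>s'\<in>UNIV. state_matrix \<pi> P $ s $ s') = (\<Sum>a\<in>UNIV. (\<Sum>s'\<in>UNIV. P $ s $ a $ s') * pmf (\<pi> s) a)"
    by (simp add: state_matrix_def sum_distrib_right) (rule sum.swap)
  also have "\<dots> = (\<Sum>a\<in>UNIV. pmf (\<pi> s) a)"
    using assms by (simp add: kernels_def prob_simplex_def)
  finally show ?thesis
    by (simp add: sum_pmf_eq_1)
qed

text \<open>Each row of the matrix is a probability vector, so its product with \<open>x\<close> averages the entries of \<open>x\<close>.\<close>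

lemma state_matrix_mult_vec_bounds:
  assumes P: "P \<in> kernels" and x: "\<And>s. l \<le> x $ s" "\<And>s. x $ s \<le> u"
  shows "l \<le> (state_matrix \<pi> P *v x) $ s" "(state_matrix \<pi> P *v x) $ s \<le> u"
proof -
  let ?M = "state_matrix \<pi> P"
  have "(\<Sum>s'\<in>UNIV. ?M $ s $ s' * l) \<le> (\<Sum>s'\<in>UNIV. ?M $ s $ s' * x $ s')"
    by (intro sum_mono mult_left_mono x state_matrix_nonneg[OF P])
  then show "l \<le> (?M *v x) $ s"
    by (simp add: matrix_vector_mult_def sum_distrib_right[symmetric] state_matrix_row_sum[OF P])
  have "(\<Sum>s'\<in>UNIV. ?M $ s $ s' * x $ s') \<le> (\<Sum>s'\<in>UNIV. ?M $ s $ s' * u)"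
    by (intro sum_mono mult_left_mono x state_matrix_nonneg[OF P])
  then show "(?M *v x) $ s \<le> u"
    by (simp add: matrix_vector_mult_def sum_distrib_right[symmetric] state_matrix_row_sum[OF P])
qed

lemma state_matrix_diff_mult_vec_bound:
  assumes P: "P \<in> kernels" and Q: "Q \<in> kernels" and x: "\<And>s. l \<le> x $ s" "\<And>s. x $ s \<le> u"
  shows "\<bar>((state_matrix \<pi> Q - state_matrix \<pi> P) *v x) $ s\<bar> \<le> u - l"
  using state_matrix_mult_vec_bounds[OF P x, of \<pi> s] state_matrix_mult_vec_bounds[OF Q x, of \<pi> s]
  by (simp add: matrix_vector_mult_diff_rdistrib)

lemma state_matrix_convex_step:
  "state_matrix \<pi> ((1 - \<alpha>) *\<^sub>R P + \<alpha> *\<^sub>R Q) - state_matrix \<pi> P = \<alpha> *\<^sub>R (state_matrix \<pi> Q - state_matrix \<pi> P)"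
  by (simp add: vec_eq_iff state_matrix_def algebra_simps sum.distrib sum_subtractf sum_distrib_left)

text \<open>Row \<open>s\<close> of the transition matrix depends only on block \<open>s\<close> of the kernel, which is why blockwise
  choices act on each state separately.\<close>

lemma state_matrix_mult_vec_block:
  "Q $ s = P $ s \<Longrightarrow> (state_matrix \<pi> Q *v x) $ s = (state_matrix \<pi> P *v x) $ s"
  by (simp add: state_matrix_def matrix_vector_mult_def)

lemma pmf_state_law_Suc:
  assumes "P \<in> kernels"
  shows "pmf (state_law \<pi> P s0 (Suc t)) s' =
     (\<Sum>s\<in>UNIV. pmf (state_law \<pi> P s0 t) s * state_matrix \<pi> P $ s $ s')"
  by (simp add: pmf_bind integral_measure_pmf[where A=UNIV] pmf_kernel[OF assms] state_matrix_def mult_ac)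

text \<open>The unnormalized visitation distribution, for all initial states at once; it is \<open>(I - \<gamma> M)\<^sup>-\<^sup>1\<close> for kernels.\<close>

definition occupancy ::
    "real \<Rightarrow> ('s::finite \<Rightarrow> 'a::finite pmf) \<Rightarrow> ('s, 'a) kernel \<Rightarrow> real^'s^'s" where
  "occupancy \<gamma> \<pi> P = (\<chi> s s'. \<Sum>t. \<gamma> ^ t * pmf (state_law \<pi> P s t) s')"

context
  fixes \<gamma> :: real
  assumes \<gamma>: "0 < \<gamma>" "\<gamma> < 1"
begin

lemma summable_discounted_law: "summable (\<lambda>t. \<gamma> ^ t * pmf (state_law \<pi> P s t) s')"
proof (rule summable_comparison_test')
  show "summable (\<lambda>t. \<gamma> ^ t)"
    using \<gamma> by (simp add: summable_geometric)
  show "norm (\<gamma> ^ t * pmf (state_law \<pi> P s t) s') \<le> \<gamma> ^ t" for t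
    using \<gamma> by (simp add: abs_mult pmf_le_1 mult_left_le)
qed

lemma occupancy_nonneg: "0 \<le> occupancy \<gamma> \<pi> P $ s $ s'"
  using \<gamma> by (simp add: occupancy_def suminf_nonneg summable_discounted_law)

lemma occupancy_row_sum: "(\<Sum>s'\<in>UNIV. occupancy \<gamma> \<pi> P $ s $ s') = 1 / (1 - \<gamma>)"
proof -
  have "(\<Sum>s'\<in>UNIV. occupancy \<gamma> \<pi> P $ s $ s') = (\<Sum>t. \<Sum>s'\<in>UNIV. \<gamma> ^ t * pmf (state_law \<pi> P s t) s')"
    by (simp add: occupancy_def suminf_sum summable_discounted_law)
  also have "\<dots> = (\<Sum>t. \<gamma> ^ t)"
    by (simp add: sum_distrib_left[symmetric] sum_pmf_eq_1)
  finally show ?thesis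
    using \<gamma> by (simp add: suminf_geometric)
qed

text \<open>Splitting off the term \<open>t = 0\<close> and using the Chapman-Kolmogorov step for the remaining terms gives
  \<open>R = I + \<gamma> R M\<close>.\<close>

lemma occupancy_inverse:
  assumes P: "P \<in> kernels"
  shows "occupancy \<gamma> \<pi> P ** (mat 1 - \<gamma> *\<^sub>R state_matrix \<pi> P) = mat 1"
proof -
  let ?O = "occupancy \<gamma> \<pi> P" and ?M = "state_matrix \<pi> P"
  have fixpoint: "?O $ s $ s' - \<gamma> * (\<Sum>k\<in>UNIV. ?O $ s $ k * ?M $ k $ s') = (if s = s' then 1 else 0)" for s s'
  proof -
    have summ: "summable (\<lambda>t. \<gamma> ^ t * pmf (state_law \<pi> P s t) k * ?M $ k $ s')" for k
      by (intro summable_mult2 summable_discounted_law)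
    have "?O $ s $ s' = pmf (state_law \<pi> P s 0) s' + (\<Sum>t. \<gamma> ^ Suc t * pmf (state_law \<pi> P s (Suc t)) s')"
      using suminf_split_head[OF summable_discounted_law[of \<pi> P s s']] by (simp add: occupancy_def del: state_law.simps)
    also have "(\<Sum>t. \<gamma> ^ Suc t * pmf (state_law \<pi> P s (Suc t)) s')
        = (\<Sum>t. \<gamma> * (\<Sum>k\<in>UNIV. \<gamma> ^ t * pmf (state_law \<pi> P s t) k * ?M $ k $ s'))"
      by (simp add: pmf_state_law_Suc[OF P] sum_distrib_left mult_ac del: state_law.simps)
    also have "\<dots> = \<gamma> * (\<Sum>k\<in>UNIV. \<Sum>t. \<gamma> ^ t * pmf (state_law \<pi> P s t) k * ?M $ k $ s')"
      by (simp only: suminf_mult[OF summable_sum[OF summ]] suminf_sum[OF summ])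
    also have "\<dots> = \<gamma> * (\<Sum>k\<in>UNIV. ?O $ s $ k * ?M $ k $ s')"
      by (simp add: occupancy_def suminf_mult2[symmetric] summable_discounted_law)
    finally show ?thesis
      by (simp add: pmf_return indicator_def)
  qed
  have "(?O ** (mat 1 - \<gamma> *\<^sub>R ?M)) $ s $ s' = ?O $ s $ s' - \<gamma> * (\<Sum>k\<in>UNIV. ?O $ s $ k * ?M $ k $ s')" for s s'
  proof -
    have "(\<Sum>k\<in>UNIV. ?O $ s $ k * mat 1 $ k $ s') = ?O $ s $ s'"
      by (simp add: mat_def if_distrib cong: if_cong)
    then show ?thesis
      by (simp add: matrix_matrix_mult_def right_diff_distrib sum_subtractf sum_distrib_left mult.left_commute)
  qed
  then show ?thesis
    by (simp add: vec_eq_iff fixpoint mat_def)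
qed

lemma invertible_resolvent:
  "P \<in> kernels \<Longrightarrow> invertible (mat 1 - \<gamma> *\<^sub>R state_matrix \<pi> P)"
  using occupancy_inverse invertible_left_inverse by blast

lemma matrix_inv_eq_occupancy:
  assumes P: "P \<in> kernels"
  shows "matrix_inv (mat 1 - \<gamma> *\<^sub>R state_matrix \<pi> P) = occupancy \<gamma> \<pi> P"
proof -
  let ?A = "mat 1 - \<gamma> *\<^sub>R state_matrix \<pi> P"
  have "occupancy \<gamma> \<pi> P = occupancy \<gamma> \<pi> P ** (?A ** matrix_inv ?A)"
    using matrix_inv_right_left(1)[OF invertible_resolvent[OF P]] by simp
  also have "\<dots> = matrix_inv ?A"
    by (simp add: matrix_mul_assoc occupancy_inverse[OF P])
  finally show ?thesis ..
qed

lemma visitation_eq_occupancy: "visitation \<gamma> \<pi> P s0 s = (1 - \<gamma>) * occupancy \<gamma> \<pi> P $ s0 $ s"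
  by (simp add: visitation_def prob_process_state occupancy_def)

text \<open>Irreducibility makes one term of the series positive. This keeps the quotients in the mismatch
  coefficient from degenerating.\<close>

lemma visitation_pos:
  assumes "irreducible_chain \<pi> P"
  shows "0 < visitation \<gamma> \<pi> P s0 s"
proof -
  obtain t where "0 < \<P>(\<omega> in process \<pi> P s0. fst (\<omega> t) = s)"
    using assms unfolding irreducible_chain_def by blast
  then have "0 < \<gamma> ^ t * pmf (state_law \<pi> P s0 t) s"
    using \<gamma> by (simp add: prob_process_state)
  then have "0 < (\<Sum>t. \<gamma> ^ t * pmf (state_law \<pi> P s0 t) s)"
    using \<gamma> by (intro suminf_pos2[OF summable_discounted_law]) auto
  then show ?thesis
    using \<gamma> by (simp add: visitation_eq_occupancy occupancy_def)
qed

text \<open>The discounted costs are dominated by a geometric series, so expectation and summation can be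
  exchanged, after which only the state marginals matter.\<close>

lemma value_fun_eq_occupancy:
  assumes cost: "\<And>s a. 0 \<le> c s a \<and> c s a \<le> 1"
  shows "value_fun \<gamma> c \<pi> P s0 = (occupancy \<gamma> \<pi> P *v policy_cost c \<pi>) $ s0"
proof -
  interpret prob_space "process \<pi> P s0"
    by (rule prob_space_process)
  let ?X = "\<lambda>t \<omega>. \<gamma> ^ t * c (fst (\<omega> t)) (snd (\<omega> t))"
  have bound: "norm (?X t \<omega>) \<le> \<gamma> ^ t" for t \<omega>
    using \<gamma> cost by (simp add: abs_mult mult_left_le)
  have geo: "summable (\<lambda>t. \<gamma> ^ t)"
    using \<gamma> by (simp add: summable_geometric)
  have meas [measurable]: "?X t \<in> borel_measurable (process \<pi> P s0)" for t
    by (rule measurable_compose[OF measurable_process_component, of "\<lambda>x. \<gamma> ^ t * c (fst x) (snd x)"]) simp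
  have integrable: "integrable (process \<pi> P s0) (?X t)" for t
    by (rule integrable_const_bound[where B="\<gamma> ^ t"]) (use bound in auto)
  have expect: "(\<integral>\<omega>. ?X t \<omega> \<partial>process \<pi> P s0)
      = (\<Sum>s\<in>UNIV. \<gamma> ^ t * pmf (state_law \<pi> P s0 t) s * policy_cost c \<pi> $ s)" for t
    by (simp add: expectation_process_cost sum_distrib_left mult_ac)
  have "(\<lambda>t. \<integral>\<omega>. ?X t \<omega> \<partial>process \<pi> P s0) sums value_fun \<gamma> c \<pi> P s0"
    unfolding value_fun_def
  proof (rule sums_integral[OF integrable])
    show "AE \<omega> in process \<pi> P s0. summable (\<lambda>t. norm (?X t \<omega>))"
      by (intro AE_I2 summable_comparison_test'[OF geo]) (use bound in auto)
    have "(\<integral>\<omega>. norm (?X t \<omega>) \<partial>process \<pi> P s0) \<le> \<gamma> ^ t" for t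
    proof -
      have "(\<integral>\<omega>. norm (?X t \<omega>) \<partial>process \<pi> P s0) \<le> (\<integral>\<omega>. \<gamma> ^ t \<partial>process \<pi> P s0)"
        by (rule integral_mono[OF integrable_norm[OF integrable] integrable_const]) (use bound in auto)
      then show ?thesis
        by (simp add: prob_space)
    qed
    then show "summable (\<lambda>t. \<integral>\<omega>. norm (?X t \<omega>) \<partial>process \<pi> P s0)"
      by (intro summable_comparison_test'[OF geo]) simp
  qed
  then have "value_fun \<gamma> c \<pi> P s0
      = (\<Sum>t. \<Sum>s\<in>UNIV. \<gamma> ^ t * pmf (state_law \<pi> P s0 t) s * policy_cost c \<pi> $ s)"
    unfolding expect by (simp add: sums_iff)
  also have "\<dots> = (\<Sum>s\<in>UNIV. \<Sum>t. \<gamma> ^ t * pmf (state_law \<pi> P s0 t) s * policy_cost c \<pi> $ s)"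
    by (intro suminf_sum summable_mult2 summable_discounted_law)
  also have "\<dots> = (occupancy \<gamma> \<pi> P *v policy_cost c \<pi>) $ s0"
    by (simp add: matrix_vector_mult_def occupancy_def suminf_mult2[symmetric] summable_discounted_law)
  finally show ?thesis .
qed

end

section \<open>The gradient of the value function\<close>

lemma tendsto_state_matrix:
  "(f \<longlongrightarrow> P) F \<Longrightarrow> ((\<lambda>x. state_matrix \<pi> (f x)) \<longlongrightarrow> state_matrix \<pi> P) F"
  unfolding state_matrix_def by (intro tendsto_intros)

text \<open>Defined through the inverse rather than the occupancy matrix, since the gradient involves points near
  a kernel that are not kernels.\<close>

definition value_vec ::
    "real \<Rightarrow> ('s::finite \<Rightarrow> 'a::finite \<Rightarrow> real) \<Rightarrow> ('s \<Rightarrow> 'a pmf) \<Rightarrow> ('s, 'a) kernel \<Rightarrow> real^'s" where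
  "value_vec \<gamma> c \<pi> P = matrix_inv (mat 1 - \<gamma> *\<^sub>R state_matrix \<pi> P) *v policy_cost c \<pi>"

lemma value_ext_eq_vec: "value_ext \<gamma> c \<pi> P s = value_vec \<gamma> c \<pi> P $ s"
  by (simp add: value_ext_def value_vec_def)

lemma state_matrix_diff: "state_matrix \<pi> (Q - P) = state_matrix \<pi> Q - state_matrix \<pi> P"
  by (simp add: vec_eq_iff state_matrix_def left_diff_distrib sum_subtractf)

text \<open>The directional derivative of the value is naturally a linear form in the change of the transition
  matrix, as on the right; the vector on the left represents it on the entries of the kernel.\<close>

lemma inner_kernel_eq:
  "inner (H :: ('s::finite, 'a::finite) kernel) (\<chi> s a s'. u $ s * pmf (\<pi> s) a * v $ s') =
     (\<Sum>s\<in>UNIV. u $ s * (state_matrix \<pi> H *v v) $ s)"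
proof -
  have "(\<Sum>a\<in>UNIV. \<Sum>s'\<in>UNIV. H $ s $ a $ s' * (u $ s * pmf (\<pi> s) a * v $ s'))
      = u $ s * (state_matrix \<pi> H *v v) $ s" for s
    unfolding state_matrix_def matrix_vector_mult_def
    by (simp add: sum_distrib_left sum_distrib_right mult_ac) (rule sum.swap)
  then show ?thesis
    by (simp add: inner_vec_def)
qed

text \<open>The coefficient in the second resolvent identity is continuous in \<open>Q\<close> at \<open>P\<close>, because the value vector is;
  evaluated at \<open>Q = P\<close> it is therefore the gradient.\<close>

lemma fw_gap_formula:
  assumes inv: "invertible (mat 1 - \<gamma> *\<^sub>R state_matrix \<pi> P)"
  shows "fw_gap \<gamma> c \<pi> s0 P Q = \<gamma> * (matrix_inv (mat 1 - \<gamma> *\<^sub>R state_matrix \<pi> P) *v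
    ((state_matrix \<pi> Q - state_matrix \<pi> P) *v value_vec \<gamma> c \<pi> P)) $ s0"
proof -
  let ?R = "matrix_inv (mat 1 - \<gamma> *\<^sub>R state_matrix \<pi> P)"
  \<comment> \<open>The gradient is \<open>g (value_vec \<gamma> c \<pi> P)\<close>. For a kernel its entries are, up to the factor \<open>\<gamma>\<close>, the occupancy of \<open>s\<close>
    times the probability of \<open>a\<close> times the value of \<open>s'\<close>.\<close>
  define u where "u = \<gamma> *\<^sub>R ?R $ s0"
  define g where "g v = (\<chi> s a s'. u $ s * pmf (\<pi> s) a * v $ s')" for v :: "real^'a"
  have inner_g: "inner (Q - P) (g v) = \<gamma> * (?R *v ((state_matrix \<pi> Q - state_matrix \<pi> P) *v v)) $ s0" for Q v
    unfolding g_def inner_kernel_eq state_matrix_diff u_def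
    by (simp add: matrix_vector_mult_def[of ?R] sum_distrib_left mult_ac)
  have resolvent_tendsto: "((\<lambda>Q. mat 1 - \<gamma> *\<^sub>R state_matrix \<pi> Q) \<longlongrightarrow> mat 1 - \<gamma> *\<^sub>R state_matrix \<pi> P) (at P)"
    by (intro tendsto_intros tendsto_state_matrix)
  have "GDERIV (\<lambda>P. value_ext \<gamma> c \<pi> P s0) P :> g (value_vec \<gamma> c \<pi> P)"
  proof (rule GDERIV_inner_diff[where g="\<lambda>Q. g (value_vec \<gamma> c \<pi> Q)"])
    have "((\<lambda>Q. value_vec \<gamma> c \<pi> Q) \<longlongrightarrow> value_vec \<gamma> c \<pi> P) (at P)"
      unfolding value_vec_def by (rule tendsto_matrix_inv_mult_vec[OF resolvent_tendsto inv])
    then show "((\<lambda>Q. g (value_vec \<gamma> c \<pi> Q)) \<longlongrightarrow> g (value_vec \<gamma> c \<pi> P)) (at P)"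
      unfolding g_def by (intro tendsto_intros)
    have "eventually (\<lambda>Q. det (mat 1 - \<gamma> *\<^sub>R state_matrix \<pi> Q) \<noteq> 0) (at P)"
      using inv by (intro tendsto_imp_eventually_ne[OF tendsto_det[OF resolvent_tendsto]]) (simp add: invertible_det_nz)
    then show "eventually (\<lambda>Q. value_ext \<gamma> c \<pi> Q s0 - value_ext \<gamma> c \<pi> P s0 =
        inner (Q - P) (g (value_vec \<gamma> c \<pi> Q))) (at P)"
    proof eventually_elim
      case (elim Q)
      then have "value_vec \<gamma> c \<pi> Q - value_vec \<gamma> c \<pi> P =
          \<gamma> *\<^sub>R (?R *v ((state_matrix \<pi> Q - state_matrix \<pi> P) *v value_vec \<gamma> c \<pi> Q))"
        unfolding value_vec_def by (intro matrix_inv_diff_mult_vec[OF inv]) (simp add: invertible_det_nz)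
      then have "(value_vec \<gamma> c \<pi> Q - value_vec \<gamma> c \<pi> P) $ s0 =
          \<gamma> * (?R *v ((state_matrix \<pi> Q - state_matrix \<pi> P) *v value_vec \<gamma> c \<pi> Q)) $ s0"
        by simp
      then show ?case
        by (simp add: value_ext_eq_vec inner_g)
    qed
  qed
  then have "value_grad \<gamma> c \<pi> s0 P = g (value_vec \<gamma> c \<pi> P)"
    unfolding value_grad_def by (intro the_equality) (auto intro: GDERIV_unique)
  then show ?thesis
    by (simp add: fw_gap_def inner_g inner_commute[of "g _"])
qed

lemma s_rectangular_select:
  assumes "s_rectangular U" "P \<in> U" "Q \<in> U"
  shows "(\<chi> s. if b s then Q $ s else P $ s) \<in> U"
  using assms unfolding s_rectangular_def by auto

lemma policy_cost_bounds:
  assumes cost: "\<And>s a. 0 \<le> c s a \<and> c s a \<le> 1"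
  shows "0 \<le> policy_cost c \<pi> $ s" "policy_cost c \<pi> $ s \<le> 1"
proof -
  show "0 \<le> policy_cost c \<pi> $ s"
    using cost by (simp add: policy_cost_def sum_nonneg)
  have "(\<Sum>a\<in>UNIV. pmf (\<pi> s) a * c s a) \<le> (\<Sum>a\<in>UNIV. pmf (\<pi> s) a * 1)"
    using cost by (intro sum_mono mult_left_mono) auto
  then show "policy_cost c \<pi> $ s \<le> 1"
    by (simp add: policy_cost_def sum_pmf_eq_1)
qed

context
  fixes \<gamma> :: real
  assumes \<gamma>: "0 < \<gamma>" "\<gamma> < 1"
begin

lemma abs_occupancy_mult_vec_le:
  assumes x: "\<And>s. \<bar>x $ s\<bar> \<le> B"
  shows "\<bar>(occupancy \<gamma> \<pi> P *v x) $ s\<bar> \<le> B / (1 - \<gamma>)"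
proof -
  let ?O = "occupancy \<gamma> \<pi> P"
  have "\<bar>(?O *v x) $ s\<bar> \<le> (\<Sum>k\<in>UNIV. \<bar>?O $ s $ k * x $ k\<bar>)"
    by (simp add: matrix_vector_mult_def sum_abs)
  also have "\<dots> \<le> (\<Sum>k\<in>UNIV. ?O $ s $ k * B)"
    using x by (intro sum_mono) (simp add: abs_mult occupancy_nonneg[OF \<gamma>] mult_left_mono)
  also have "\<dots> = B / (1 - \<gamma>)"
    by (simp add: sum_distrib_right[symmetric] occupancy_row_sum[OF \<gamma>])
  finally show ?thesis .
qed

lemma value_vec_eq_occupancy:
  "P \<in> kernels \<Longrightarrow> value_vec \<gamma> c \<pi> P = occupancy \<gamma> \<pi> P *v policy_cost c \<pi>"
  by (simp add: value_vec_def matrix_inv_eq_occupancy[OF \<gamma>])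

lemma value_vec_diff:
  assumes P: "P \<in> kernels" and Q: "Q \<in> kernels"
  shows "value_vec \<gamma> c \<pi> Q - value_vec \<gamma> c \<pi> P =
    \<gamma> *\<^sub>R (occupancy \<gamma> \<pi> P *v ((state_matrix \<pi> Q - state_matrix \<pi> P) *v value_vec \<gamma> c \<pi> Q))"
  using matrix_inv_diff_mult_vec[OF invertible_resolvent[OF \<gamma> P] invertible_resolvent[OF \<gamma> Q]]
  unfolding value_vec_def by (simp only: matrix_inv_eq_occupancy[OF \<gamma>] P Q)

lemma fw_gap_kernels:
  assumes P: "P \<in> kernels"
  shows "fw_gap \<gamma> c \<pi> s0 P Q =
    \<gamma> * (occupancy \<gamma> \<pi> P *v ((state_matrix \<pi> Q - state_matrix \<pi> P) *v value_vec \<gamma> c \<pi> P)) $ s0"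
  using fw_gap_formula[OF invertible_resolvent[OF \<gamma> P]] by (simp add: matrix_inv_eq_occupancy[OF \<gamma> P])

lemma continuous_on_value_vec:
  assumes "U \<subseteq> kernels"
  shows "continuous_on U (value_vec \<gamma> c \<pi>)"
  unfolding continuous_on_def value_vec_def[abs_def]
  using assms by (auto intro!: tendsto_matrix_inv_mult_vec tendsto_intros tendsto_state_matrix invertible_resolvent[OF \<gamma>])

lemma continuous_on_visitation:
  assumes "U \<subseteq> kernels"
  shows "continuous_on U (\<lambda>P. visitation \<gamma> \<pi> P s0 s)"
proof -
  have "continuous_on U (\<lambda>P. (1 - \<gamma>) * (matrix_inv (mat 1 - \<gamma> *\<^sub>R state_matrix \<pi> P) *v axis s 1) $ s0)"
    unfolding continuous_on_def
    using assms by (auto intro!: tendsto_matrix_inv_mult_vec tendsto_intros tendsto_state_matrix invertible_resolvent[OF \<gamma>])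
  moreover have "(1 - \<gamma>) * (matrix_inv (mat 1 - \<gamma> *\<^sub>R state_matrix \<pi> P) *v axis s 1) $ s0 = visitation \<gamma> \<pi> P s0 s"
    if "P \<in> U" for P
    using that assms
    by (simp add: matrix_inv_eq_occupancy[OF \<gamma>] visitation_eq_occupancy[OF \<gamma>] subsetD matrix_vector_mul_component inner_axis)
  ultimately show ?thesis
    by (simp cong: continuous_on_cong)
qed

section \<open>Gradient dominance under rectangularity\<close>

text \<open>The visitation frequencies are continuous and positive on the compact set \<open>U\<close>, so the maximum that
  defines the coefficient is attained and bounds every quotient.\<close>

lemma mismatch_coeff_bound:
  assumes U: "U \<subseteq> kernels" "compact U" "s_rectangular U"
    and irr: "\<And>P. P \<in> U \<Longrightarrow> irreducible_chain \<pi> P"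
    and P: "P \<in> U" and P': "P' \<in> U"
  shows "occupancy \<gamma> \<pi> P' $ s0 $ s \<le> mismatch_coeff \<gamma> \<pi> U s0 * occupancy \<gamma> \<pi> P $ s0 $ s"
    and "0 \<le> mismatch_coeff \<gamma> \<pi> U s0"
proof -
  define ratio where "ratio s = (\<lambda>(P, P'). visitation \<gamma> \<pi> P' s0 s / visitation \<gamma> \<pi> P s0 s)" for s
  define A where "A = (\<Union>s. ratio s ` (U \<times> U))"
  have pos: "0 < visitation \<gamma> \<pi> P s0 s" if "P \<in> U" for P s
    by (rule visitation_pos[OF \<gamma> irr[OF that]])
  have vis: "continuous_on (U \<times> U) (\<lambda>x. visitation \<gamma> \<pi> (h x) s0 s)"
    if "continuous_on (U \<times> U) h" "h ` (U \<times> U) \<subseteq> U" for h :: "_ \<Rightarrow> ('a, 'b) kernel" and s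
    by (rule continuous_on_compose2[OF continuous_on_visitation[OF U(1)] that])
  have "continuous_on (U \<times> U) (ratio s)" for s
  proof -
    have "\<forall>x\<in>U \<times> U. visitation \<gamma> \<pi> (fst x) s0 s \<noteq> 0"
      using pos by (metis less_irrefl mem_Times_iff)
    then show ?thesis
      unfolding ratio_def case_prod_beta by (intro continuous_on_divide vis continuous_intros) auto
  qed
  then have "compact A"
    unfolding A_def by (intro compact_UN compact_continuous_image compact_Times U) auto
  moreover have "A \<noteq> {}"
    using P unfolding A_def by blast
  ultimately have le: "y \<le> (GREATEST x. x \<in> A)" if "y \<in> A" for y
    using attained_Greatest(2) that by blast
  have "mismatch_coeff \<gamma> \<pi> U s0 = (GREATEST x. x \<in> A)"
    unfolding mismatch_coeff_def A_def ratio_def hull_same[of s_rectangular, OF U(3)]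
    by (intro arg_cong[where f=Greatest] ext) auto
  with le have ratio_le: "visitation \<gamma> \<pi> P' s0 s / visitation \<gamma> \<pi> P s0 s \<le> mismatch_coeff \<gamma> \<pi> U s0" for s
    using P P' unfolding A_def ratio_def by force
  have "0 \<le> visitation \<gamma> \<pi> P' s0 s / visitation \<gamma> \<pi> P s0 s"
    using pos[OF P, of s] pos[OF P', of s] by simp
  also note ratio_le
  finally show "0 \<le> mismatch_coeff \<gamma> \<pi> U s0" .
  have "visitation \<gamma> \<pi> P' s0 s \<le> mismatch_coeff \<gamma> \<pi> U s0 * visitation \<gamma> \<pi> P s0 s"
    using ratio_le[of s] pos[OF P, of s] by (simp add: divide_le_eq)
  then show "occupancy \<gamma> \<pi> P' $ s0 $ s \<le> mismatch_coeff \<gamma> \<pi> U s0 * occupancy \<gamma> \<pi> P $ s0 $ s"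
    using \<gamma> by (simp add: visitation_eq_occupancy[OF \<gamma>] mult.left_commute)
qed

text \<open>At a state with \<open>g < 0\<close> moving from the block of \<open>P\<close> to that of \<open>P'\<close> lowers the first-order value; rectangularity allows
  leaving that block unchanged. All remaining contributions are nonnegative, which is what allows the two
  occupancies to be compared by a multiplicative constant.\<close>

lemma gradient_dominance:
  assumes U: "U \<subseteq> kernels" "compact U" "s_rectangular U"
    and irr: "\<And>P. P \<in> U \<Longrightarrow> irreducible_chain \<pi> P"
    and P: "P \<in> U" and P': "P' \<in> U"
  obtains Q where "Q \<in> U"
    and "value_vec \<gamma> c \<pi> P' $ s0 - value_vec \<gamma> c \<pi> P $ s0 \<le> mismatch_coeff \<gamma> \<pi> U s0 * fw_gap \<gamma> c \<pi> s0 P Q"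
proof
  let ?\<delta> = "mismatch_coeff \<gamma> \<pi> U s0" and ?M = "state_matrix \<pi>" and ?v = "value_vec \<gamma> c \<pi> P"
  define g where "g = (?M P' - ?M P) *v ?v"
  define Q where "Q = (\<chi> s. if 0 \<le> g $ s then P' $ s else P $ s)"
  show "Q \<in> U"
    unfolding Q_def by (rule s_rectangular_select[OF U(3) P P'])
  have g_Q: "((?M Q - ?M P) *v ?v) $ s = max (g $ s) 0" for s
    using state_matrix_mult_vec_block[of Q s P' \<pi> ?v] state_matrix_mult_vec_block[of Q s P \<pi> ?v]
    by (cases "0 \<le> g $ s") (auto simp: Q_def g_def matrix_vector_mult_diff_rdistrib)
  have kernels: "P \<in> kernels" "P' \<in> kernels"
    using U P P' by auto
  \<comment> \<open>The identity is expanded around \<open>P'\<close>, so that the value vector of \<open>P\<close> stands in \<open>g\<close>, as in the gradient at \<open>P\<close>.\<close>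
  have "?v - value_vec \<gamma> c \<pi> P' = - (\<gamma> *\<^sub>R (occupancy \<gamma> \<pi> P' *v g))"
    unfolding value_vec_diff[OF kernels(2) kernels(1)] g_def
    by (simp add: matrix_vector_mult_diff_rdistrib matrix_vector_mult_diff_distrib algebra_simps)
  then have "(?v - value_vec \<gamma> c \<pi> P') $ s0 = (- (\<gamma> *\<^sub>R (occupancy \<gamma> \<pi> P' *v g))) $ s0"
    by simp
  then have "value_vec \<gamma> c \<pi> P' $ s0 - ?v $ s0 = \<gamma> * (\<Sum>s\<in>UNIV. occupancy \<gamma> \<pi> P' $ s0 $ s * g $ s)"
    by (simp add: matrix_vector_mult_def)
  also have "\<dots> \<le> \<gamma> * (\<Sum>s\<in>UNIV. ?\<delta> * (occupancy \<gamma> \<pi> P $ s0 $ s * max (g $ s) 0))"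
  proof (intro mult_left_mono sum_mono)
    fix s
    have "occupancy \<gamma> \<pi> P' $ s0 $ s * g $ s \<le> occupancy \<gamma> \<pi> P' $ s0 $ s * max (g $ s) 0"
      by (intro mult_left_mono occupancy_nonneg[OF \<gamma>]) simp
    also have "\<dots> \<le> (?\<delta> * occupancy \<gamma> \<pi> P $ s0 $ s) * max (g $ s) 0"
      using mismatch_coeff_bound(1)[OF U irr P P'] by (intro mult_right_mono) auto
    finally show "occupancy \<gamma> \<pi> P' $ s0 $ s * g $ s \<le> ?\<delta> * (occupancy \<gamma> \<pi> P $ s0 $ s * max (g $ s) 0)"
      by (simp add: mult.assoc)
  qed (use \<gamma> in auto)
  also have "\<dots> = ?\<delta> * fw_gap \<gamma> c \<pi> s0 P Q"
    unfolding fw_gap_kernels[OF kernels(1)]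
    by (simp add: matrix_vector_mult_def[of "occupancy \<gamma> \<pi> P"] g_Q sum_distrib_left mult_ac)
  finally show "value_vec \<gamma> c \<pi> P' $ s0 - ?v $ s0 \<le> ?\<delta> * fw_gap \<gamma> c \<pi> s0 P Q" .
qed

section \<open>Ascent and termination\<close>

context
  fixes c :: "'s::finite \<Rightarrow> 'a::finite \<Rightarrow> real"
  assumes cost: "\<And>s a. 0 \<le> c s a \<and> c s a \<le> 1"
begin

lemma value_fun_eq_value_vec: "P \<in> kernels \<Longrightarrow> value_fun \<gamma> c \<pi> P s = value_vec \<gamma> c \<pi> P $ s"
  by (simp add: value_fun_eq_occupancy[OF \<gamma> cost] value_vec_eq_occupancy)

lemma value_vec_bounds:
  assumes P: "P \<in> kernels"
  shows "0 \<le> value_vec \<gamma> c \<pi> P $ s" "value_vec \<gamma> c \<pi> P $ s \<le> 1 / (1 - \<gamma>)"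
proof -
  show "0 \<le> value_vec \<gamma> c \<pi> P $ s"
    unfolding value_vec_eq_occupancy[OF P] matrix_vector_mult_def
    by (simp add: sum_nonneg occupancy_nonneg[OF \<gamma>] policy_cost_bounds(1)[OF cost])
  have "\<bar>policy_cost c \<pi> $ s\<bar> \<le> 1" for s
    using policy_cost_bounds[OF cost, where \<pi>=\<pi> and s=s] by simp
  from abs_occupancy_mult_vec_le[OF this, where \<pi>=\<pi> and P=P and s=s]
  show "value_vec \<gamma> c \<pi> P $ s \<le> 1 / (1 - \<gamma>)"
    by (simp add: value_vec_eq_occupancy[OF P])
qed

text \<open>With \<open>D = M\<^sub>Q - M\<^sub>P\<close>, the increment \<open>w\<close> of the value vector satisfies
  \<open>w = \<gamma> \<alpha> R D (v\<^sub>P + w)\<close>. The part with \<open>v\<^sub>P\<close> is \<open>\<alpha>\<close> times the gap, and the part with \<open>w\<close> is of order \<open>\<alpha>\<^sup>2\<close>,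
  since \<open>w\<close> itself carries a factor \<open>\<alpha>\<close>.\<close>

lemma value_vec_ascent:
  assumes P: "P \<in> kernels" and Q: "Q \<in> kernels" and \<alpha>: "0 \<le> \<alpha>"
    and step: "P' = (1 - \<alpha>) *\<^sub>R P + \<alpha> *\<^sub>R Q" "P' \<in> kernels"
  shows "value_vec \<gamma> c \<pi> P $ s0 + \<alpha> * fw_gap \<gamma> c \<pi> s0 P Q - 2 * \<gamma>\<^sup>2 * \<alpha>\<^sup>2 / (1 - \<gamma>) ^ 3
    \<le> value_vec \<gamma> c \<pi> P' $ s0"
proof -
  let ?O = "occupancy \<gamma> \<pi> P" and ?v = "value_vec \<gamma> c \<pi>"
  define D where "D = state_matrix \<pi> Q - state_matrix \<pi> P"
  define w where "w = ?v P' - ?v P"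
  \<comment> \<open>The bound for \<open>w\<close>: entries of \<open>D *v value_vec \<gamma> c \<pi> P'\<close> are at most \<open>1 / (1 - \<gamma>)\<close> in
    absolute value, and \<open>R\<close> has row sums \<open>1 / (1 - \<gamma>)\<close>.\<close>
  define B where "B = \<gamma> * \<alpha> * (1 / (1 - \<gamma>) / (1 - \<gamma>))"
  have D_step: "state_matrix \<pi> P' - state_matrix \<pi> P = \<alpha> *\<^sub>R D"
    unfolding D_def step(1) by (rule state_matrix_convex_step)
  have w: "w = (\<gamma> * \<alpha>) *\<^sub>R (?O *v (D *v ?v P'))"
    unfolding w_def value_vec_diff[OF P step(2)] D_step
    by (simp add: scaleR_matrix_vector_assoc[symmetric] linear_scale[OF matrix_vector_mul_linear])
  have D_v: "\<bar>(D *v ?v P') $ s\<bar> \<le> 1 / (1 - \<gamma>)" for s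
    using state_matrix_diff_mult_vec_bound[OF P Q value_vec_bounds[OF step(2)], where \<pi>=\<pi> and s=s] by (simp add: D_def)
  have w_le: "\<bar>w $ s\<bar> \<le> B" for s
  proof -
    have "\<bar>w $ s\<bar> = \<gamma> * \<alpha> * \<bar>(?O *v (D *v ?v P')) $ s\<bar>"
      using \<gamma> \<alpha> by (simp add: w abs_mult)
    also have "\<dots> \<le> B"
      unfolding B_def using \<gamma> \<alpha> by (intro mult_left_mono abs_occupancy_mult_vec_le D_v) auto
    finally show ?thesis .
  qed
  \<comment> \<open>The entries of \<open>w\<close> lie in \<open>[- B, B]\<close>, and two averages of them differ by at most the length of that interval.\<close>
  have "\<bar>(D *v w) $ s\<bar> \<le> B - (- B)" for s
    unfolding D_def using w_le by (intro state_matrix_diff_mult_vec_bound[OF P Q]) (simp_all add: abs_le_iff minus_le_iff)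
  then have "\<bar>(D *v w) $ s\<bar> \<le> 2 * B" for s
    by simp
  from abs_occupancy_mult_vec_le[OF this, where \<pi>=\<pi> and P=P and s=s0]
  have remainder: "- (2 * B / (1 - \<gamma>)) \<le> (?O *v (D *v w)) $ s0"
    by (simp add: abs_le_iff)
  have split: "?v P' = ?v P + w"
    by (simp add: w_def)
  have "w $ s0 = ((\<gamma> * \<alpha>) *\<^sub>R (?O *v (D *v (?v P + w)))) $ s0"
    using arg_cong[where f="\<lambda>x. x $ s0", OF w] unfolding split .
  also have "\<dots> = \<alpha> * fw_gap \<gamma> c \<pi> s0 P Q + \<gamma> * \<alpha> * (?O *v (D *v w)) $ s0"
    by (simp add: fw_gap_kernels[OF P] D_def[symmetric] matrix_vector_right_distrib distrib_left mult_ac)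
  finally have "w $ s0 = \<alpha> * fw_gap \<gamma> c \<pi> s0 P Q + \<gamma> * \<alpha> * (?O *v (D *v w)) $ s0" .
  moreover have "\<gamma> * \<alpha> * - (2 * B / (1 - \<gamma>)) \<le> \<gamma> * \<alpha> * (?O *v (D *v w)) $ s0"
    using \<gamma> \<alpha> remainder by (intro mult_left_mono) auto
  moreover have "\<gamma> * \<alpha> * - (2 * B / (1 - \<gamma>)) = - (2 * \<gamma>\<^sup>2 * \<alpha>\<^sup>2 / (1 - \<gamma>) ^ 3)"
    by (simp add: B_def power2_eq_square power3_eq_cube)
  ultimately show ?thesis
    by (simp add: w_def)
qed

lemma worst_case_value_attained:
  assumes U: "U \<subseteq> kernels" "compact U" "U \<noteq> {}"
  obtains P where "P \<in> U" "worst_case_value \<gamma> c \<pi> U s0 = value_vec \<gamma> c \<pi> P $ s0"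
proof -
  have "compact ((\<lambda>P. value_vec \<gamma> c \<pi> P $ s0) ` U)"
    by (intro compact_continuous_image continuous_on_component continuous_on_value_vec U)
  moreover have "(\<lambda>P. value_vec \<gamma> c \<pi> P $ s0) ` U = (\<lambda>P. value_fun \<gamma> c \<pi> P s0) ` U"
    using U by (intro image_cong) (auto simp: value_fun_eq_value_vec)
  ultimately have "worst_case_value \<gamma> c \<pi> U s0 \<in> (\<lambda>P. value_vec \<gamma> c \<pi> P $ s0) ` U"
    unfolding worst_case_value_def using attained_Greatest(1) U(3) by (metis image_is_empty)
  then show ?thesis
    using that by blast
qed

text \<open>The values along the iterates would otherwise grow at least linearly, although they are bounded.\<close>

lemma fw_terminates:
  assumes U: "U \<subseteq> kernels"
    and \<epsilon>: "0 < \<epsilon>"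
    and run: "frank_wolfe_run \<gamma> c \<pi> s0 U \<epsilon> \<alpha> Pm Qm"
    and stepsizes: "\<And>m. fw_executed \<gamma> c \<pi> s0 \<epsilon> Pm Qm (Suc m) \<Longrightarrow>
          \<alpha> m = fw_gap \<gamma> c \<pi> s0 (Pm m) (Qm m) * (1 - \<gamma>) ^ 3 / (4 * \<gamma>\<^sup>2)"
    and feasible: "\<And>m. fw_executed \<gamma> c \<pi> s0 \<epsilon> Pm Qm m \<Longrightarrow> Pm m \<in> U"
  shows "\<exists>Phat. fw_output \<gamma> c \<pi> s0 \<epsilon> Pm Qm Phat"
proof (rule ccontr)
  assume no_output: "\<nexists>Phat. fw_output \<gamma> c \<pi> s0 \<epsilon> Pm Qm Phat"
  let ?G = "\<lambda>m. fw_gap \<gamma> c \<pi> s0 (Pm m) (Qm m)" and ?v = "\<lambda>m. value_vec \<gamma> c \<pi> (Pm m) $ s0"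
  \<comment> \<open>The guaranteed gain per iteration: the value of \<open>\<alpha> G - 2 \<gamma>\<^sup>2 \<alpha>\<^sup>2 / (1 - \<gamma>)\<^sup>3\<close> at its maximizer
    \<open>\<alpha> = G (1 - \<gamma>)\<^sup>3 / (4 \<gamma>\<^sup>2)\<close> is \<open>G\<^sup>2 (1 - \<gamma>)\<^sup>3 / (8 \<gamma>\<^sup>2)\<close>, and \<open>G > \<epsilon>\<close> until termination.\<close>
  define \<kappa> where "\<kappa> = \<epsilon>\<^sup>2 * (1 - \<gamma>) ^ 3 / (8 * \<gamma>\<^sup>2)"
  have gap: "\<epsilon> < ?G m" for m
  proof (induction m rule: less_induct)
    case (less m)
    then have "fw_executed \<gamma> c \<pi> s0 \<epsilon> Pm Qm m"
      by (simp add: fw_executed_def)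
    with no_output show ?case
      unfolding fw_output_def by (meson not_le)
  qed
  then have exec: "fw_executed \<gamma> c \<pi> s0 \<epsilon> Pm Qm m" for m
    by (simp add: fw_executed_def)
  have kernels: "Pm m \<in> kernels" "Qm m \<in> kernels" for m
    using feasible[OF exec] run exec U by (auto simp: frank_wolfe_run_def eps_optimal_direction_def)
  have \<alpha>: "\<alpha> m = ?G m * (1 - \<gamma>) ^ 3 / (4 * \<gamma>\<^sup>2)" for m
    by (rule stepsizes[OF exec])
  have increase: "?v m + \<kappa> \<le> ?v (Suc m)" for m
  proof -
    have "0 \<le> \<alpha> m"
      unfolding \<alpha> using gap[of m] \<epsilon> \<gamma> by simp
    moreover have "Pm (Suc m) = (1 - \<alpha> m) *\<^sub>R Pm m + \<alpha> m *\<^sub>R Qm m"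
      using run exec by (simp add: frank_wolfe_run_def)
    ultimately have "?v m + \<alpha> m * ?G m - 2 * \<gamma>\<^sup>2 * (\<alpha> m)\<^sup>2 / (1 - \<gamma>) ^ 3 \<le> ?v (Suc m)"
      by (rule value_vec_ascent[OF kernels _ _ kernels(1)])
    moreover have "\<alpha> m * ?G m - 2 * \<gamma>\<^sup>2 * (\<alpha> m)\<^sup>2 / (1 - \<gamma>) ^ 3 = (?G m)\<^sup>2 * (1 - \<gamma>) ^ 3 / (8 * \<gamma>\<^sup>2)"
    proof -
      define r where "r = (1 - \<gamma>) ^ 3"
      have "r \<noteq> 0" "\<gamma> \<noteq> 0"
        using \<gamma> by (auto simp: r_def)
      then show ?thesis
        unfolding \<alpha> r_def[symmetric] by (simp add: field_simps power2_eq_square)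
    qed
    moreover have "\<kappa> \<le> (?G m)\<^sup>2 * (1 - \<gamma>) ^ 3 / (8 * \<gamma>\<^sup>2)"
      unfolding \<kappa>_def using gap[of m] \<epsilon> \<gamma> by (intro divide_right_mono mult_right_mono power_mono) auto
    ultimately show ?thesis
      by linarith
  qed
  have growth: "real m * \<kappa> \<le> ?v m" for m
  proof (induction m)
    case 0
    show ?case
      using value_vec_bounds(1)[OF kernels(1)] by simp
  next
    case (Suc m)
    then show ?case
      using increase[of m] by (simp add: algebra_simps)
  qed
  have "0 < \<kappa>"
    using \<epsilon> \<gamma> by (simp add: \<kappa>_def)
  then obtain m where "1 / (1 - \<gamma>) < real m * \<kappa>"
    using reals_Archimedean3 by blast
  with growth[of m] value_vec_bounds(2)[OF kernels(1), of \<pi> m s0] show False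
    by linarith
qed

end

end

section \<open>Guarantee for the output\<close>

theorem corollary3p13:
  fixes \<gamma> \<epsilon> :: real
    and c :: "'s::finite \<Rightarrow> 'a::finite \<Rightarrow> real"
    and \<pi> :: "'s \<Rightarrow> 'a pmf"
    and s0 :: 's
    and \<Xi> :: "(real^'q::finite) set"
    and kernel_of :: "real^'q \<Rightarrow> ('s, 'a) kernel"
    and U :: "('s, 'a) kernel set"
    and \<alpha> :: "nat \<Rightarrow> real"
    and Pm Qm :: "nat \<Rightarrow> ('s, 'a) kernel"
  assumes discount: "0 < \<gamma>" "\<gamma> < 1"
    and cost: "\<And>s a. 0 \<le> c s a \<and> c s a \<le> 1"
    and parameters: "convex \<Xi>" "compact \<Xi>"
    and affine_kernel: "\<exists>L b. linear L \<and> (\<forall>\<xi>\<in>\<Xi>. kernel_of \<xi> = L \<xi> + b)"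
    and uncertainty_set: "U = kernel_of ` \<Xi>" "U \<subseteq> kernels"
    and irreducible: "\<And>P. P \<in> s_rectangular hull U \<Longrightarrow> irreducible_chain \<pi> P"
    and tolerance: "0 < \<epsilon>"
    and rectangular: "s_rectangular U"
    and run: "frank_wolfe_run \<gamma> c \<pi> s0 U \<epsilon> \<alpha> Pm Qm"
    and stepsizes: "\<And>m. fw_executed \<gamma> c \<pi> s0 \<epsilon> Pm Qm (Suc m) \<Longrightarrow>
          \<alpha> m = fw_gap \<gamma> c \<pi> s0 (Pm m) (Qm m) * (1 - \<gamma>) ^ 3 / (4 * \<gamma>\<^sup>2)"
    and feasible: "\<And>m. fw_executed \<gamma> c \<pi> s0 \<epsilon> Pm Qm m \<Longrightarrow> Pm m \<in> U"
  shows "(\<exists>Phat. fw_output \<gamma> c \<pi> s0 \<epsilon> Pm Qm Phat) \<and>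
    (\<forall>Phat. fw_output \<gamma> c \<pi> s0 \<epsilon> Pm Qm Phat \<longrightarrow>
       worst_case_value \<gamma> c \<pi> U s0 - value_fun \<gamma> c \<pi> Phat s0
         \<le> 2 * mismatch_coeff \<gamma> \<pi> U s0 * \<epsilon>)"
proof (intro conjI allI impI)
  show "\<exists>Phat. fw_output \<gamma> c \<pi> s0 \<epsilon> Pm Qm Phat"
    by (rule fw_terminates[OF discount cost uncertainty_set(2) tolerance run stepsizes feasible])
next
  fix Phat
  assume "fw_output \<gamma> c \<pi> s0 \<epsilon> Pm Qm Phat"
  then obtain m where exec: "fw_executed \<gamma> c \<pi> s0 \<epsilon> Pm Qm m"
    and gap: "fw_gap \<gamma> c \<pi> s0 (Pm m) (Qm m) \<le> \<epsilon>" and Phat: "Phat = Pm m"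
    unfolding fw_output_def by blast
  let ?\<delta> = "mismatch_coeff \<gamma> \<pi> U s0"
  have Phat_U: "Phat \<in> U"
    unfolding Phat by (rule feasible[OF exec])
  obtain L b where L: "linear L" "\<And>\<xi>. \<xi> \<in> \<Xi> \<Longrightarrow> kernel_of \<xi> = L \<xi> + b"
    using affine_kernel by blast
  have "U = (\<lambda>\<xi>. L \<xi> + b) ` \<Xi>"
    unfolding uncertainty_set(1) by (rule image_cong) (simp_all add: L(2))
  moreover have "continuous_on \<Xi> (\<lambda>\<xi>. L \<xi> + b)"
    by (intro continuous_intros linear_continuous_on linear_conv_bounded_linear[THEN iffD1] L(1))
  ultimately have compact: "compact U"
    using parameters(2) by (simp add: compact_continuous_image)
  have irr: "irreducible_chain \<pi> P" if "P \<in> U" for P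
    using irreducible that by (simp add: hull_same rectangular)
  have gap_le: "fw_gap \<gamma> c \<pi> s0 Phat Q \<le> 2 * \<epsilon>" if "Q \<in> U" for Q
  proof -
    have "fw_gap \<gamma> c \<pi> s0 Phat Q - \<epsilon> \<le> fw_gap \<gamma> c \<pi> s0 (Pm m) (Qm m)"
      using run exec that unfolding Phat frank_wolfe_run_def eps_optimal_direction_def by blast
    with gap show ?thesis
      by simp
  qed
  have nonempty: "U \<noteq> {}"
    using Phat_U by blast
  obtain P where P: "P \<in> U" "worst_case_value \<gamma> c \<pi> U s0 = value_vec \<gamma> c \<pi> P $ s0"
    by (rule worst_case_value_attained[OF discount cost uncertainty_set(2) compact nonempty])
  obtain Q where Q: "Q \<in> U"
    "value_vec \<gamma> c \<pi> P $ s0 - value_vec \<gamma> c \<pi> Phat $ s0 \<le> ?\<delta> * fw_gap \<gamma> c \<pi> s0 Phat Q"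
    by (rule gradient_dominance[OF discount uncertainty_set(2) compact rectangular irr Phat_U P(1)])
  have Phat_value: "value_fun \<gamma> c \<pi> Phat s0 = value_vec \<gamma> c \<pi> Phat $ s0"
    using Phat_U uncertainty_set(2) by (intro value_fun_eq_value_vec[OF discount cost]) auto
  have "?\<delta> * fw_gap \<gamma> c \<pi> s0 Phat Q \<le> ?\<delta> * (2 * \<epsilon>)"
    by (intro mult_left_mono gap_le[OF Q(1)]
        mismatch_coeff_bound(2)[OF discount uncertainty_set(2) compact rectangular irr Phat_U Phat_U])
  with Q(2) show "worst_case_value \<gamma> c \<pi> U s0 - value_fun \<gamma> c \<pi> Phat s0 \<le> 2 * ?\<delta> * \<epsilon>"
    unfolding P(2) Phat_value by (simp add: mult_ac)
qed

end
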